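(* Let $n\ge 2$, and let $(s_i)_{i\in[0,(k+1)(n+1)[}$ and $(s'_i)_{i\in[0,(k+1)(n+1)[}$ be two distinct strings, with entries in $[0,n[$, satisfying conditions (N0)–(N5) and condition (N6') (defined in the context). Then they correspond to distinct (i.e. non-isomorphic) ADFAs.
   Context: Intervals are intervals of integers: $[a,b]=\{i\in\mathbb{Z}: a\le i\le b\}$, $[a,b[=\{i\in\mathbb{Z}: a\le i<b\}$. Lexicographic order on finite sequences over a totally ordered set: compare at the first differing position; a proper prefix is smaller. An ADFA is a trim complete acyclic deterministic finite automaton: a complete DFA with state set $S\cup\{\Omega\}$, $\Omega\notin S$, whose dead state $\Omega$ is non-final, not initial and loops to itself on all letters, in which no nonempty word maps a state of $S$ to itself, every state of $S$ is reachable from the initial state, and from every state of $S$ a final state is reachable. Isomorphism: two DFAs $(S,\Sigma,\delta,s_0,F)$ and $(S',\Sigma',\delta',s_0',F')$ are isomorphic if $|\Sigma|=|\Sigma'|=k$ and there exist bijections $\Pi_1:\Sigma\to[0,k-1]$, $\Pi_2:\Sigma'\to[0,k-1]$ and a bijection $\iota:S\to S'$ such that $\iota(s_0)=s_0'$, $\iota(F)=F'$, and $\iota(\delta(s,\sigma))=\delta'(\iota(s),\Pi_2^{-1}(\Pi_1(\sigma)))$ for all $\sigma\in\Sigma$ and $s\in S$ (here $S,S'$ are the full state sets). Automaton corresponding to a string $(s_i)_{i\in[0,(k+1)(n+1)[}$ with $s_i\in[0,n[$: alphabet $[0,k[$ (with its natural order), dead state $\Omega=0$, $S=[1,n]$,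 initial state $n$, transitions $\delta(i,m)=s_{(k+1)i+m}$ for $i\in[0,n]$, $m\in[0,k[$ (extended to words as usual), and $F=\{i: s_{(k+1)i+k}=1\}$. Write $\Delta(i)=(s_{(k+1)i+m})_{m\in[0,k]}$. The string satisfies (N0)–(N5) and (N6') if there are $d\le n$ and integers $(r_l)_{l\in[0,d]}$ in $[1,n]$ (the first states of each rank; put $r_{-1}=0$, $r_{d+1}=n+1$, and let $R_l=[r_l,r_{l+1}[$ be the set of states of rank $l$), and positions $(f_i)_{i\in[1,n[}$ (the positions of the first occurrence of each $i\in[1,n[$), each of the form $(k+1)j+m$ with $j\in[0,n]$, $m\in[0,k[$, such that: (N0) $s_0=\cdots=s_k=\cdots=s_{2k}=0$ and $s_{2k+1}=1$; (N1) for all $i\in[0,n]$, $s_{(k+1)i+k}\in\{0,1\}$; (N2) $r_0=1$, $r_1=2$, $r_d=n$, and $r_l<r_{l+1}$ for all $l\in[0,d[$; (N3) for all $i\in[1,n[$: $s_{f_i}=i$, and for all $j\in[0,n]$ and $m\in[0,k[$, if $(k+1)j+m<f_i$ then $s_{(k+1)j+m}\ne i$; (N4) for all $l\in[0,d[$ and all $i\in[r_l,r_{l+1}[$: $kr_{l+1}+1\le f_i$; (N5) for all $l\in[0,d]$ and all $i\in[r_l,r_{l+1}[$ there is $m\in[0,k[$ with $s_{(k+1)i+m}\in[r_{l-1},r_l[$; (N6') for all $l\in[0,d[$ and all $i\in R_l$: $i\prec_{\Psi_c} i+1$. Here $i\prec_{\Psi_c}i'$ means: $\Delta(i)<\Delta(i')$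 lexicographically, or $\Delta(i)=\Delta(i')$ and $\Psi_c(i)<\Psi_c(i')$ lexicographically (in the second case it is understood that both characteristic words exist). The characteristic word $\Psi_c(i)$ of $i\in[1,n]$ is defined as follows. The rank of a state $p\in[1,n]$ is the $l$ with $p\in R_l$, and its finality is $s_{(k+1)p+k}$. For each word $\sigma_l\cdots\sigma_0$ over $[0,k[$ with $\delta(n,\sigma_l\cdots\sigma_0)=i$, form the sequence $\tau_0\tau_1\cdots\tau_l$, where $\tau_j$ is the triple (rank of $p_j$, $\sigma_j$, finality of $p_j$) and $p_j=\delta(n,\sigma_l\cdots\sigma_{j+1})$ (the empty word gives the empty sequence, for $i=n$). $\Psi_c(i)$ is the lexicographically least such sequence, triples being compared lexicographically.
   Formalization: Isomorphism is taken with order-preserving bijections Π_1, Π_2 (no permutation of letters), and (N4) reads (k+1)r_{l+1} ≤ f_i instead of k r_{l+1}+1 ≤ f_i; with either taken literally the claim has counterexamples. *)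

theory Defs
  imports Main "HOL-Library.List_Lexorder" "HOL-Library.Product_Lexorder"
begin

record ('q, 'a) dfa =
  states :: "'q set"
  alphabet :: "'a set"
  step :: "'q \<Rightarrow> 'a \<Rightarrow> 'q"
  init :: 'q
  final :: "'q set"

definition complete_dfa :: "('q, 'a) dfa \<Rightarrow> bool" where
  "complete_dfa M \<longleftrightarrow>
     finite (states M) \<and> finite (alphabet M) \<and> init M \<in> states M \<and> final M \<subseteq> states M \<and>
     (\<forall>q \<in> states M. \<forall>a \<in> alphabet M. step M q a \<in> states M)"

abbreviation run :: "('q, 'a) dfa \<Rightarrow> 'q \<Rightarrow> 'a list \<Rightarrow> 'q" where
  "run M \<equiv> foldl (step M)"

definition adfa :: "('q, 'a) dfa \<Rightarrow> 'q \<Rightarrow> bool" where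
  "adfa M \<Omega> \<longleftrightarrow>
     complete_dfa M \<and>
     \<Omega> \<in> states M \<and> \<Omega> \<notin> final M \<and> \<Omega> \<noteq> init M \<and> (\<forall>a \<in> alphabet M. step M \<Omega> a = \<Omega>) \<and>
     (\<forall>q \<in> states M - {\<Omega>}. \<forall>w \<in> lists (alphabet M). w \<noteq> [] \<longrightarrow> run M q w \<noteq> q) \<and>
     (\<forall>q \<in> states M - {\<Omega>}. \<exists>w \<in> lists (alphabet M). run M (init M) w = q) \<and>
     (\<forall>q \<in> states M - {\<Omega>}. \<exists>w \<in> lists (alphabet M). run M q w \<in> final M)"

(* The alphabets are ordered, and the bijections onto [0,k-1] are the order-preserving ones.
   If arbitrary bijections were allowed, automata differing by a permutation of the letters
   would be isomorphic; e.g. for n = k = 2 the strings 000 001 010 and 000 001 100 would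
   yield isomorphic automata. *)
definition dfa_isomorphic ::
  "('q, 'a::linorder) dfa \<Rightarrow> ('p, 'b::linorder) dfa \<Rightarrow> bool" where
  "dfa_isomorphic M M' \<longleftrightarrow>
     card (alphabet M) = card (alphabet M') \<and>
     (\<exists>\<Pi>1 \<Pi>2 \<iota>.
        bij_betw \<Pi>1 (alphabet M) {0..<card (alphabet M)} \<and> strict_mono_on (alphabet M) \<Pi>1 \<and>
        bij_betw \<Pi>2 (alphabet M') {0..<card (alphabet M')} \<and> strict_mono_on (alphabet M') \<Pi>2 \<and>
        bij_betw \<iota> (states M) (states M') \<and>
        \<iota> (init M) = init M' \<and>
        \<iota> ` final M = final M' \<and>
        (\<forall>\<sigma> \<in> alphabet M. \<forall>q \<in> states M.
           \<iota> (step M q \<sigma>) = step M' (\<iota> q) (inv_into (alphabet M') \<Pi>2 (\<Pi>1 \<sigma>))))"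

definition string_dfa :: "nat \<Rightarrow> nat \<Rightarrow> nat list \<Rightarrow> (nat, nat) dfa" where
  "string_dfa n k s =
     \<lparr> states = {0..n},
       alphabet = {0..<k},
       step = (\<lambda>i m. s ! ((k + 1) * i + m)),
       init = n,
       final = {i \<in> {0..n}. s ! ((k + 1) * i + k) = 1} \<rparr>"

definition Delta :: "nat \<Rightarrow> nat list \<Rightarrow> nat \<Rightarrow> nat list" where
  "Delta k s i = map (\<lambda>m. s ! ((k + 1) * i + m)) [0..<k + 1]"

(* Ranks are integers because the sequence of first states starts at index -1. *)
definition rank_states :: "(int \<Rightarrow> nat) \<Rightarrow> int \<Rightarrow> nat set" where
  "rank_states r l = {r l..<r (l + 1)}"

definition state_rank :: "nat \<Rightarrow> (int \<Rightarrow> nat) \<Rightarrow> nat \<Rightarrow> int" where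
  "state_rank d r p = (THE l. l \<in> {0..int d} \<and> p \<in> rank_states r l)"

(* The word sigma_l ... sigma_0 is read from left to right by the automaton, while the
   sequence tau_0 ... tau_l lists its last letter first; hence the reversal. *)
definition triple_seq ::
  "nat \<Rightarrow> nat \<Rightarrow> nat list \<Rightarrow> nat \<Rightarrow> (int \<Rightarrow> nat) \<Rightarrow> nat list \<Rightarrow> (int \<times> nat \<times> nat) list" where
  "triple_seq n k s d r w =
     rev (map (\<lambda>j. let p = run (string_dfa n k s) n (take j w)
                   in (state_rank d r p, w ! j, s ! ((k + 1) * p + k)))
              [0..<length w])"

definition is_char_word ::
  "nat \<Rightarrow> nat \<Rightarrow> nat list \<Rightarrow> nat \<Rightarrow> (int \<Rightarrow> nat) \<Rightarrow> nat \<Rightarrow> (int \<times> nat \<times> nat) list \<Rightarrow> bool" where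
  "is_char_word n k s d r i \<psi> \<longleftrightarrow>
     (let W = {w \<in> lists {0..<k}. run (string_dfa n k s) n w = i}
      in \<psi> \<in> triple_seq n k s d r ` W \<and> (\<forall>w \<in> W. \<psi> \<le> triple_seq n k s d r w))"

definition prec_char ::
  "nat \<Rightarrow> nat \<Rightarrow> nat list \<Rightarrow> nat \<Rightarrow> (int \<Rightarrow> nat) \<Rightarrow> nat \<Rightarrow> nat \<Rightarrow> bool" where
  "prec_char n k s d r i i' \<longleftrightarrow>
     Delta k s i < Delta k s i' \<or>
     Delta k s i = Delta k s i' \<and>
     (\<exists>\<psi> \<psi>'. is_char_word n k s d r i \<psi> \<and> is_char_word n k s d r i' \<psi>' \<and> \<psi> < \<psi>')"

definition N0 :: "nat \<Rightarrow> nat list \<Rightarrow> bool" where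
  "N0 k s \<longleftrightarrow> (\<forall>j \<in> {0..2 * k}. s ! j = 0) \<and> s ! (2 * k + 1) = 1"

definition N1 :: "nat \<Rightarrow> nat \<Rightarrow> nat list \<Rightarrow> bool" where
  "N1 n k s \<longleftrightarrow> (\<forall>i \<in> {0..n}. s ! ((k + 1) * i + k) \<in> {0, 1})"

definition N2 :: "nat \<Rightarrow> nat \<Rightarrow> (int \<Rightarrow> nat) \<Rightarrow> bool" where
  "N2 n d r \<longleftrightarrow> r 0 = 1 \<and> r 1 = 2 \<and> r (int d) = n \<and> (\<forall>l \<in> {0..<int d}. r l < r (l + 1))"

definition N3 :: "nat \<Rightarrow> nat \<Rightarrow> nat list \<Rightarrow> (nat \<Rightarrow> nat) \<Rightarrow> bool" where
  "N3 n k s f \<longleftrightarrow>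
     (\<forall>i \<in> {1..<n}. s ! f i = i \<and>
        (\<forall>j \<in> {0..n}. \<forall>m \<in> {0..<k}. (k + 1) * j + m < f i \<longrightarrow> s ! ((k + 1) * j + m) \<noteq> i))"

(* Each state's description occupies k + 1 positions, so the descriptions of the states of
   rank > l start at position (k + 1) * r (l + 1): a state of rank l first occurs in the
   description of a state of greater rank.  The bound k * r (l + 1) + 1, which ignores the
   finality entries, would admit automata with cycles: for n = 3, k = 2 it is met by
   000 001 120 200 (singleton ranks), where state 2 has a loop.  Even among strings
   yielding ADFAs it would admit distinct ones with isomorphic automata: for n = 6, k = 2,
   000 001 010 010 120 340 500 (ranks {1}, {2,3}, {4}, {5}, {6}) and
   000 001 010 010 130 240 500 (ranks {1}, {2,3}, {4,5}, {6}). *)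
definition N4 :: "nat \<Rightarrow> nat \<Rightarrow> (int \<Rightarrow> nat) \<Rightarrow> (nat \<Rightarrow> nat) \<Rightarrow> bool" where
  "N4 k d r f \<longleftrightarrow> (\<forall>l \<in> {0..<int d}. \<forall>i \<in> {r l..<r (l + 1)}. (k + 1) * r (l + 1) \<le> f i)"

definition N5 :: "nat \<Rightarrow> nat list \<Rightarrow> nat \<Rightarrow> (int \<Rightarrow> nat) \<Rightarrow> bool" where
  "N5 k s d r \<longleftrightarrow>
     (\<forall>l \<in> {0..int d}. \<forall>i \<in> {r l..<r (l + 1)}.
        \<exists>m \<in> {0..<k}. s ! ((k + 1) * i + m) \<in> {r (l - 1)..<r l})"

definition N6' :: "nat \<Rightarrow> nat \<Rightarrow> nat list \<Rightarrow> nat \<Rightarrow> (int \<Rightarrow> nat) \<Rightarrow> bool" where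
  "N6' n k s d r \<longleftrightarrow>
     (\<forall>l \<in> {0..<int d}. \<forall>i \<in> rank_states r l. prec_char n k s d r i (i + 1))"

definition satisfies_N :: "nat \<Rightarrow> nat \<Rightarrow> nat list \<Rightarrow> bool" where
  "satisfies_N n k s \<longleftrightarrow>
     (\<exists>d r f.
        d \<le> n \<and>
        (\<forall>l \<in> {0..int d}. r l \<in> {1..n}) \<and> r (-1) = 0 \<and> r (int d + 1) = n + 1 \<and>
        (\<forall>i \<in> {1..<n}. \<exists>j \<in> {0..n}. \<exists>m \<in> {0..<k}. f i = (k + 1) * j + m) \<and>
        N0 k s \<and> N1 n k s \<and> N2 n d r \<and> N3 n k s f \<and> N4 k d r f \<and> N5 k s d r \<and> N6' n k s d r)"

end

theory Submission
  imports Defs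
begin

text \<open>
  Conditions (N3) and (N4) say that every transition into a state of \<open>[1,n]\<close> comes from a
  state of strictly greater rank, hence of strictly greater number; with (N5), the rank of a
  state is one more than the maximal rank of its successors, so an isomorphism \<open>\<iota>\<close> preserves
  ranks and therefore characteristic words. Suppose \<open>\<iota>\<close> fixes every state below \<open>i\<close> but not
  \<open>i\<close>. All successors of \<open>i\<close> lie below \<open>i\<close>, so \<open>\<iota>\<close> carries the comparison of \<open>i\<close> with
  its preimage, \<open>i \<prec> \<iota>\<^sup>-\<^sup>1 i\<close>, to \<open>\<iota> i \<prec> i\<close> in the second automaton. But (N6') makes \<open>\<prec>\<close>
  agree with the order of the numbers, so also \<open>i \<prec> \<iota> i\<close>, a contradiction. Hence \<open>\<iota>\<close> is
  the identity and the strings coincide.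
\<close>

section \<open>Preliminaries: increasing bijections and the order \<open>prec_char\<close>\<close>

text \<open>Everything below \<open>x\<close> is fixed, so the preimage of \<open>x\<close> is at
  least \<open>x\<close> and monotonicity gives \<open>g x \<le> x\<close>; a strictly smaller value
  would be fixed itself, against injectivity. This makes both letter bijections of an isomorphism
  trivial.\<close>

lemma strict_mono_on_bij_betw_atLeast0LessThan:
  fixes g :: "nat \<Rightarrow> nat"
  assumes "bij_betw g {0..<k} {0..<k}" "strict_mono_on {0..<k} g" "x < k"
  shows "g x = x"
  using \<open>x < k\<close>
proof (induction x rule: less_induct)
  case (less x)
  have "x \<in> g ` {0..<k}"
    using assms(1) less.prems by (auto simp: bij_betw_def)
  then obtain z where z: "z < k" "g z = x" by auto
  have "x \<le> z" using less.IH[of z] z by (cases "z < x") auto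
  then have "g x \<le> x"
    using strict_mono_onD[OF assms(2), of x z] z less.prems by (cases "x = z") auto
  moreover have False if "g x < x"
  proof -
    have "g (g x) = g x" using less.IH[OF that] that less.prems by simp
    then have "g x = x"
      using assms(1) that less.prems by (auto simp: bij_betw_def dest!: inj_onD)
    with that show False by simp
  qed
  ultimately show ?case by fastforce
qed

lemma is_char_word_unique:
  assumes "is_char_word n k s d r i \<psi>" "is_char_word n k s d r i \<phi>"
  shows "\<psi> = \<phi>"
proof (rule antisym)
  show "\<psi> \<le> \<phi>" using assms unfolding is_char_word_def Let_def by blast
  show "\<phi> \<le> \<psi>" using assms unfolding is_char_word_def Let_def by blast
qed

text \<open>When all three \<open>Delta\<close> agree, the two comparisons chain because the
  characteristic word of \<open>j\<close> is unique.\<close>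

lemma prec_char_trans:
  assumes "prec_char n k s d r i j" "prec_char n k s d r j l"
  shows "prec_char n k s d r i l"
proof -
  consider "Delta k s i < Delta k s l"
    | "Delta k s i = Delta k s j" "Delta k s j = Delta k s l"
    using assms unfolding prec_char_def by force
  then show ?thesis
  proof cases
    case 2
    then obtain \<psi> \<phi> \<phi>' \<chi> where
      "is_char_word n k s d r i \<psi>" "is_char_word n k s d r j \<phi>" "\<psi> < \<phi>"
      "is_char_word n k s d r j \<phi>'" "is_char_word n k s d r l \<chi>" "\<phi>' < \<chi>"
      using assms unfolding prec_char_def by auto
    moreover from this have "\<phi> = \<phi>'" using is_char_word_unique by blast
    ultimately have "is_char_word n k s d r i \<psi>" "is_char_word n k s d r l \<chi>" "\<psi> < \<chi>"
      by auto
    with 2 show ?thesis unfolding prec_char_def by auto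
  qed (simp add: prec_char_def)
qed

lemma prec_char_irrefl: "\<not> prec_char n k s d r i i"
  unfolding prec_char_def using is_char_word_unique by (metis less_irrefl)

section \<open>The automaton of a single string\<close>

locale numbered_string =
  fixes n k :: nat and s :: "nat list" and d :: nat and r :: "int \<Rightarrow> nat" and f :: "nat \<Rightarrow> nat"
  assumes n_ge_2: "2 \<le> n"
    and length_s: "length s = (k + 1) * (n + 1)"
    and set_s: "set s \<subseteq> {0..<n}"
    and r_minus_1: "r (-1) = 0"
    and r_Suc_d: "r (int d + 1) = n + 1"
    and f_form: "i \<in> {1..<n} \<Longrightarrow> \<exists>j \<in> {0..n}. \<exists>m \<in> {0..<k}. f i = (k + 1) * j + m"
    and N0: "N0 k s" and N1: "N1 n k s" and N2: "N2 n d r" and N3: "N3 n k s f"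
    and N4: "N4 k d r f" and N5: "N5 k s d r" and N6': "N6' n k s d r"
begin

abbreviation M :: "(nat, nat) dfa" where "M \<equiv> string_dfa n k s"
abbreviation \<delta> :: "nat \<Rightarrow> nat \<Rightarrow> nat" where "\<delta> p m \<equiv> s ! ((k + 1) * p + m)"

text \<open>Unlike \<^const>\<open>state_rank\<close>, this gives the dead state a rank, namely \<open>-1\<close>.\<close>
definition has_rank :: "nat \<Rightarrow> int \<Rightarrow> bool" where
  "has_rank p l \<longleftrightarrow> l \<in> {-1..int d} \<and> p \<in> rank_states r l"

lemma step_M: "step M = \<delta>"
  by (simp add: string_dfa_def)

text \<open>Condition (N5) for state 1, the only state of rank 0, supplies a letter.\<close>

lemma k_pos: "0 < k"
proof -
  have "\<forall>i\<in>{r 0..<r (0 + 1)}. \<exists>m\<in>{0..<k}. s ! ((k + 1) * i + m) \<in> {r (0 - 1)..<r 0}"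
    using N5 unfolding N5_def by (rule bspec) simp
  moreover have "1 \<in> {r 0..<r (0 + 1)}" using N2 by (simp add: N2_def)
  ultimately show ?thesis by fastforce
qed

lemma \<delta>_less_n: "p \<le> n \<Longrightarrow> m \<le> k \<Longrightarrow> \<delta> p m < n"
proof -
  assume "p \<le> n" "m \<le> k"
  then have "(k + 1) * p + m < (k + 1) * p + (k + 1)" by simp
  also have "\<dots> = (k + 1) * (p + 1)" by simp
  also have "\<dots> \<le> (k + 1) * (n + 1)" using \<open>p \<le> n\<close> by (intro mult_le_mono) auto
  finally have "\<delta> p m \<in> set s" using length_s by (metis nth_mem)
  then show ?thesis using set_s by auto
qed

lemma \<delta>_0: "m \<le> k \<Longrightarrow> \<delta> 0 m = 0"
  using N0 by (auto simp: N0_def)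

lemma \<delta>_1_k: "\<delta> 1 k = 1"
  using N0 by (simp add: N0_def mult_2)

section \<open>Ranks as a partition of the states\<close>

text \<open>The conventions for \<open>r (-1)\<close> and \<open>r (int d + 1)\<close> extend the
  monotonicity in (N2) to both ends.\<close>

lemma r_less_Suc: "l \<in> {-1..int d} \<Longrightarrow> r l < r (l + 1)"
proof -
  assume "l \<in> {-1..int d}"
  then consider "l = -1" | "l = int d" | "l \<in> {0..<int d}" by fastforce
  then show ?thesis
    using N2 r_minus_1 r_Suc_d by cases (auto simp: N2_def)
qed

lemma r_mono: "a \<le> b \<Longrightarrow> -1 \<le> a \<Longrightarrow> b \<le> int d + 1 \<Longrightarrow> r a \<le> r b"
proof (induction b rule: int_ge_induct)
  case (step b)
  then show ?case using r_less_Suc[of b] by simp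
qed simp

lemma has_rank_exists: "p \<le> n \<Longrightarrow> \<exists>l. has_rank p l"
proof -
  have *: "\<exists>l. has_rank p l" if "-1 \<le> b" "b \<le> int d + 1" "p < r b" for b
    using that
  proof (induction b rule: int_ge_induct)
    case base
    then show ?case using r_minus_1 by simp
  next
    case (step b)
    then show ?case
      by (cases "p < r b") (auto simp: has_rank_def rank_states_def)
  qed
  assume "p \<le> n"
  then show ?thesis using *[of "int d + 1"] r_Suc_d by simp
qed

lemma has_rank_less:
  assumes "has_rank p a" "has_rank q b" "r (a + 1) \<le> q"
  shows "a < b"
proof (rule ccontr)
  assume "\<not> a < b"
  then have "r (b + 1) \<le> r (a + 1)"
    using assms by (intro r_mono) (auto simp: has_rank_def)
  then show False using assms by (auto simp: has_rank_def rank_states_def)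
qed

lemma has_rank_unique:
  assumes "has_rank p a" "has_rank p b"
  shows "a = b"
proof -
  have False if "has_rank p a" "has_rank p b" "a < b" for a b
    using r_mono[of "a + 1" b] that by (auto simp: has_rank_def rank_states_def)
  then show ?thesis using assms by (meson linorder_neqE)
qed

lemma has_rank_0_iff: "has_rank 0 l \<longleftrightarrow> l = -1"
proof -
  have "has_rank 0 (-1)"
    using r_minus_1 N2 by (auto simp: has_rank_def rank_states_def N2_def)
  then show ?thesis using has_rank_unique by blast
qed

lemma has_rank_nonneg:
  assumes "has_rank p l" "1 \<le> p"
  shows "0 \<le> l"
proof (rule ccontr)
  assume "\<not> 0 \<le> l"
  with assms(1) have "l = -1" by (auto simp: has_rank_def)
  with assms N2 show False by (auto simp: has_rank_def rank_states_def N2_def)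
qed

text \<open>The top rank consists of \<open>n\<close> alone, since it starts at
  \<open>r (int d) = n\<close>. Hence (N4) and (N6') cover every state in
  \<open>{1..<n}\<close>.\<close>

lemma has_rank_less_d:
  assumes "has_rank p l" "1 \<le> p" "p < n"
  shows "l \<in> {0..<int d}"
proof -
  have "l \<noteq> int d" using assms N2 by (auto simp: has_rank_def rank_states_def N2_def)
  then show ?thesis using assms has_rank_nonneg by (fastforce simp: has_rank_def)
qed

section \<open>Transitions lower the number and the rank\<close>

text \<open>Position \<open>(k + 1) * p + m\<close> holds the target, so by (N3) the first
  occurrence of the target is no later; (N4) bounds that occurrence below by
  \<open>(k + 1) * r (l + 1)\<close>. Cancelling \<open>k + 1\<close> compares the rows.\<close>

lemma r_Suc_le_source:
  assumes "p \<le> n" "m < k" "1 \<le> \<delta> p m" "has_rank (\<delta> p m) l"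
  shows "r (l + 1) \<le> p"
proof -
  let ?q = "\<delta> p m"
  have qn: "?q < n" using \<delta>_less_n assms by simp
  have "(k + 1) * r (l + 1) \<le> f ?q"
    using N4 has_rank_less_d[OF assms(4,3) qn] assms(4)
    by (auto simp: N4_def has_rank_def rank_states_def)
  also have "f ?q \<le> (k + 1) * p + m"
    using N3 assms qn unfolding N3_def by (force simp: not_less)
  also have "\<dots> < (k + 1) * (p + 1)" using assms by simp
  finally have "r (l + 1) < p + 1" by (metis mult_less_cancel1)
  then show ?thesis by simp
qed

lemma \<delta>_less:
  assumes "1 \<le> p" "p \<le> n" "m < k"
  shows "\<delta> p m < p"
proof (cases "\<delta> p m = 0")
  case False
  obtain l where l: "has_rank (\<delta> p m) l"
    using has_rank_exists \<delta>_less_n[of p m] assms by (meson less_imp_le)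
  then have "\<delta> p m < r (l + 1)" by (simp add: has_rank_def rank_states_def)
  also have "\<dots> \<le> p" using r_Suc_le_source l False assms by simp
  finally show ?thesis .
qed (use assms in simp)

lemma has_rank_\<delta>_less:
  assumes "1 \<le> p" "p \<le> n" "m < k" "has_rank p l" "has_rank (\<delta> p m) l'"
  shows "l' < l"
proof (cases "\<delta> p m = 0")
  case True
  then show ?thesis using has_rank_nonneg assms has_rank_0_iff by fastforce
next
  case False
  then show ?thesis using has_rank_less r_Suc_le_source assms by simp
qed

text \<open>Together with \<open>has_rank_\<delta>_less\<close>, this determines the rank of a live
  state from the ranks of its successors. For \<open>l = 0\<close> the successor is the dead state,
  which is why that state gets rank -1.\<close>

lemma has_rank_\<delta>_exists:
  assumes "1 \<le> p" "has_rank p l"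
  obtains m where "m < k" "has_rank (\<delta> p m) (l - 1)"
proof -
  have "0 \<le> l" using has_rank_nonneg assms by simp
  then have "\<exists>m\<in>{0..<k}. \<delta> p m \<in> {r (l - 1)..<r l}"
    using N5 assms by (auto simp: N5_def has_rank_def rank_states_def)
  then show ?thesis using that \<open>0 \<le> l\<close> assms
    by (auto simp: has_rank_def rank_states_def)
qed

lemma run_le: "w \<in> lists {0..<k} \<Longrightarrow> p \<le> n \<Longrightarrow> run M p w \<le> p"
proof (induction w arbitrary: p)
  case (Cons m w)
  have "\<delta> p m \<le> p"
    using \<delta>_less[of p m] \<delta>_0[of m] Cons.prems by (cases "p = 0") auto
  then show ?case using Cons.IH[of "\<delta> p m"] Cons.prems by (simp add: step_M)
qed simp

lemma run_less:
  assumes "w \<in> lists {0..<k}" "w \<noteq> []" "1 \<le> p" "p \<le> n"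
  shows "run M p w < p"
proof (cases w)
  case (Cons m v)
  then have "\<delta> p m < p" using \<delta>_less assms by simp
  then show ?thesis using run_le[of v "\<delta> p m"] assms Cons by (simp add: step_M)
qed (use assms in simp)

section \<open>The automaton is trim and acyclic\<close>

text \<open>The row containing position \<open>f p\<close> is a predecessor of \<open>p\<close> with
  a larger number, so the induction climbs up to the initial state \<open>n\<close>.\<close>

lemma accessible: "1 \<le> p \<Longrightarrow> p \<le> n \<Longrightarrow> \<exists>w \<in> lists {0..<k}. run M n w = p"
proof (induction "n - p" arbitrary: p rule: less_induct)
  case less
  show ?case
  proof (cases "p = n")
    case True
    then show ?thesis by (intro bexI[of _ "[]"]) auto
  next
    case False
    then have p: "p \<in> {1..<n}" using less.prems by simp
    obtain j m where jm: "j \<le> n" "m < k" "f p = (k + 1) * j + m"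
      using f_form[OF p] by auto
    have j: "\<delta> j m = p" using N3 p jm by (metis N3_def)
    \<comment> \<open>Row 0 contains only zeros.\<close>
    have "1 \<le> j" using \<delta>_0[of m] j jm p by (cases j) auto
    then have "p < j" using \<delta>_less[of j m] j jm by simp
    then have "n - j < n - p" "1 \<le> j" using p by auto
    then obtain w where w: "w \<in> lists {0..<k}" "run M n w = j"
      using less.hyps[of j] jm(1) by blast
    show ?thesis
      by (rule bexI[of _ "w @ [m]"]) (use w j jm in \<open>auto simp: step_M\<close>)
  qed
qed

text \<open>State 1 is final by (N0). Any other live state has positive rank, so (N5) gives a
  successor of nonnegative rank, which is live and has a smaller number.\<close>

lemma coaccessible: "1 \<le> p \<Longrightarrow> p \<le> n \<Longrightarrow> \<exists>w \<in> lists {0..<k}. run M p w \<in> final M"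
proof (induction p rule: less_induct)
  case (less p)
  show ?case
  proof (cases "p = 1")
    case True
    then show ?thesis using \<delta>_1_k less.prems
      by (intro bexI[of _ "[]"]) (auto simp: string_dfa_def)
  next
    case False
    obtain l where l: "has_rank p l" using has_rank_exists less.prems by blast
    have "0 < l"
      using has_rank_less[of 1 0 p l] N2 False less.prems l
      by (auto simp: N2_def has_rank_def rank_states_def)
    obtain m where m: "m < k" "has_rank (\<delta> p m) (l - 1)"
      using has_rank_\<delta>_exists l less.prems by blast
    have "\<delta> p m \<noteq> 0" using m(2) \<open>0 < l\<close> has_rank_0_iff[of "l - 1"] by (intro notI) simp
    moreover have "\<delta> p m < p" using \<delta>_less less.prems m by simp
    ultimately obtain w where "w \<in> lists {0..<k}" "run M (\<delta> p m) w \<in> final M"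
      using less.IH[of "\<delta> p m"] less.prems by auto
    then show ?thesis using m by (intro bexI[of _ "m # w"]) (auto simp: step_M)
  qed
qed

lemma adfa: "adfa M 0"
proof -
  have "complete_dfa M"
    using \<delta>_less_n by (auto simp: complete_dfa_def string_dfa_def less_imp_le)
  moreover have "alphabet M = {0..<k}" "states M - {0} = {1..n}" "init M = n"
    by (auto simp: string_dfa_def)
  moreover have "0 \<in> states M" "0 \<notin> final M" "0 \<noteq> init M" "\<forall>a\<in>alphabet M. step M 0 a = 0"
    using n_ge_2 \<delta>_0 by (auto simp: string_dfa_def)
  ultimately show ?thesis
    using run_less accessible coaccessible unfolding adfa_def
    by (metis atLeastAtMost_iff less_irrefl)
qed

text \<open>Condition (N6') also compares the last state of a rank with the first state of the next
  one, so transitivity chains across rank boundaries.\<close>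

lemma prec_char_if_less:
  assumes "1 \<le> i" "i < j" "j \<le> n"
  shows "prec_char n k s d r i j"
proof -
  have *: "prec_char n k s d r p (Suc p)" if p: "1 \<le> p" "p < n" for p
  proof -
    obtain l where l: "has_rank p l" using has_rank_exists[of p] p by (meson less_imp_le)
    then have "l \<in> {0..<int d}" using has_rank_less_d p by simp
    then show ?thesis using N6' l by (auto simp: N6'_def has_rank_def)
  qed
  from assms(2) have "Suc i \<le> j" by simp
  then show ?thesis using \<open>j \<le> n\<close>
  proof (induction j rule: dec_induct)
    case base
    then show ?case using * assms by simp
  next
    case (step j)
    then show ?case using *[of j] prec_char_trans[of n k s d r i j "Suc j"] assms by simp
  qed
qed

end

section \<open>Invariants of an isomorphism\<close>

text \<open>The letter bijections are already eliminated: \<open>\<iota>_\<delta>\<close> has the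
  same letter on both sides. Each string keeps its own witnesses for ranks and first
  occurrences.\<close>

locale numbered_strings_iso =
  A: numbered_string n k s d r f + B: numbered_string n k s' d' r' f'
  for n k s d r f s' d' r' f' +
  fixes \<iota> :: "nat \<Rightarrow> nat"
  assumes bij: "bij_betw \<iota> {0..n} {0..n}"
    and \<iota>_n: "\<iota> n = n"
    and \<iota>_final: "\<iota> ` final A.M = final B.M"
    and \<iota>_\<delta>: "p \<le> n \<Longrightarrow> m < k \<Longrightarrow> \<iota> (A.\<delta> p m) = B.\<delta> (\<iota> p) m"
begin

lemma \<iota>_le: "p \<le> n \<Longrightarrow> \<iota> p \<le> n"
  using bij by (auto simp: bij_betw_def)

lemma \<iota>_eq_iff: "p \<le> n \<Longrightarrow> q \<le> n \<Longrightarrow> \<iota> p = \<iota> q \<longleftrightarrow> p = q"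
  using bij by (auto simp: bij_betw_def dest: inj_onD)

text \<open>The image of the dead state inherits its loops, whereas every transition from a live
  state strictly lowers the number.\<close>

lemma \<iota>_0: "\<iota> 0 = 0"
proof (rule ccontr)
  assume "\<iota> 0 \<noteq> 0"
  then have "B.\<delta> (\<iota> 0) 0 < \<iota> 0"
    using B.\<delta>_less[of "\<iota> 0" 0] \<iota>_le[of 0] A.k_pos by simp
  then show False using \<iota>_\<delta>[of 0 0] A.\<delta>_0[of 0] A.k_pos by simp
qed

lemma finality_\<iota>: "p \<le> n \<Longrightarrow> B.\<delta> (\<iota> p) k = A.\<delta> p k"
proof -
  assume p: "p \<le> n"
  have "\<iota> p \<in> final B.M \<longleftrightarrow> p \<in> final A.M"
    unfolding \<iota>_final[symmetric] using \<iota>_eq_iff p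
    by (fastforce simp: string_dfa_def)
  then have "B.\<delta> (\<iota> p) k = 1 \<longleftrightarrow> A.\<delta> p k = 1"
    using p \<iota>_le by (auto simp: string_dfa_def)
  moreover have "A.\<delta> p k \<in> {0, 1}" "B.\<delta> (\<iota> p) k \<in> {0, 1}"
    using A.N1 B.N1 p \<iota>_le by (auto simp: N1_def)
  ultimately show ?thesis by auto
qed

text \<open>A successor of rank \<open>a - 1\<close> has an image of the same rank by induction, and
  this image is a successor of \<open>\<iota> p\<close>, so \<open>a \<le> b\<close>. A successor of
  \<open>\<iota> p\<close> of rank \<open>b - 1\<close> gives the converse.\<close>

lemma has_rank_\<iota>_eq:
  "p \<le> n \<Longrightarrow> A.has_rank p a \<Longrightarrow> B.has_rank (\<iota> p) b \<Longrightarrow> a = b"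
proof (induction p arbitrary: a b rule: less_induct)
  case (less p)
  show ?case
  proof (cases "p = 0")
    case True
    then show ?thesis using less.prems \<iota>_0 A.has_rank_0_iff B.has_rank_0_iff by simp
  next
    case False
    then have p: "1 \<le> p" by simp
    have \<iota>p: "1 \<le> \<iota> p" "\<iota> p \<le> n"
      using \<iota>_eq_iff[of p 0] \<iota>_0 False \<iota>_le less.prems by auto
    have succ: "A.\<delta> p m < p" "A.\<delta> p m \<le> n" if "m < k" for m
      using A.\<delta>_less[of p m] p less.prems that by auto
    obtain m where m: "m < k" "A.has_rank (A.\<delta> p m) (a - 1)"
      using A.has_rank_\<delta>_exists[OF p less.prems(2)] .
    obtain c where c: "B.has_rank (\<iota> (A.\<delta> p m)) c"
      using B.has_rank_exists \<iota>_le succ m by meson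
    then have "c < b"
      using B.has_rank_\<delta>_less[OF \<iota>p m(1) less.prems(3)] \<iota>_\<delta> m less.prems by simp
    with less.IH[OF succ[OF m(1)] m(2) c] have "a \<le> b" by simp
    obtain m' where m': "m' < k" "B.has_rank (B.\<delta> (\<iota> p) m') (b - 1)"
      using B.has_rank_\<delta>_exists[OF \<iota>p(1) less.prems(3)] .
    then have B: "B.has_rank (\<iota> (A.\<delta> p m')) (b - 1)" using \<iota>_\<delta> less.prems by simp
    obtain c' where c': "A.has_rank (A.\<delta> p m') c'"
      using A.has_rank_exists succ m' by meson
    then have "c' < a"
      using A.has_rank_\<delta>_less[OF p less.prems(1) m'(1) less.prems(2)] by simp
    with less.IH[OF succ[OF m'(1)] c' B] have "b \<le> a" by simp
    with \<open>a \<le> b\<close> show ?thesis by simp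
  qed
qed

lemma has_rank_\<iota>_iff: "p \<le> n \<Longrightarrow> B.has_rank (\<iota> p) l \<longleftrightarrow> A.has_rank p l"
  using has_rank_\<iota>_eq A.has_rank_exists B.has_rank_exists \<iota>_le by metis

text \<open>Both descriptions range over the same predicate. This covers the dead state too, where
  no \<open>l\<close> qualifies and both sides are the same unspecified value.\<close>

lemma state_rank_\<iota>: "p \<le> n \<Longrightarrow> state_rank d' r' (\<iota> p) = state_rank d r p"
proof -
  assume "p \<le> n"
  then have "l \<in> {0..int d'} \<and> \<iota> p \<in> rank_states r' l \<longleftrightarrow>
      l \<in> {0..int d} \<and> p \<in> rank_states r l" for l
    using has_rank_\<iota>_iff[of p l] unfolding A.has_rank_def B.has_rank_def by auto
  then show ?thesis unfolding state_rank_def by simp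
qed

lemma run_\<iota>: "w \<in> lists {0..<k} \<Longrightarrow> p \<le> n \<Longrightarrow> run B.M (\<iota> p) w = \<iota> (run A.M p w)"
proof (induction w arbitrary: p)
  case (Cons m w)
  have "A.\<delta> p m \<le> n" using A.\<delta>_less_n[of p m] Cons.prems by simp
  then have "run B.M (\<iota> (A.\<delta> p m)) w = \<iota> (run A.M (A.\<delta> p m) w)"
    using Cons by simp
  then show ?case using \<iota>_\<delta>[of p m] Cons.prems by (simp add: A.step_M B.step_M)
qed simp

lemma triple_seq_\<iota>:
  assumes "w \<in> lists {0..<k}"
  shows "triple_seq n k s' d' r' w = triple_seq n k s d r w"
proof -
  have "state_rank d' r' (run B.M n (take j w)) = state_rank d r (run A.M n (take j w))"
       "B.\<delta> (run B.M n (take j w)) k = A.\<delta> (run A.M n (take j w)) k" for j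
  proof -
    have w: "take j w \<in> lists {0..<k}" using assms by (auto dest: in_set_takeD)
    then have "run B.M n (take j w) = \<iota> (run A.M n (take j w))"
      using run_\<iota>[of "take j w" n] \<iota>_n by simp
    moreover have "run A.M n (take j w) \<le> n" using A.run_le w by simp
    ultimately show "state_rank d' r' (run B.M n (take j w)) = state_rank d r (run A.M n (take j w))"
       "B.\<delta> (run B.M n (take j w)) k = A.\<delta> (run A.M n (take j w)) k"
      using state_rank_\<iota> finality_\<iota> by simp_all
  qed
  then show ?thesis unfolding triple_seq_def Let_def by simp
qed

text \<open>The same input words reach \<open>i\<close> and \<open>\<iota> i\<close>, with equal
  triple sequences. As an equality of predicates it transfers existence along with the word.\<close>

lemma is_char_word_\<iota>:
  assumes "i \<le> n"
  shows "is_char_word n k s' d' r' (\<iota> i) = is_char_word n k s d r i"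
proof -
  have "{w \<in> lists {0..<k}. run B.M n w = \<iota> i} = {w \<in> lists {0..<k}. run A.M n w = i}"
    (is "?W' = ?W")
  proof (rule Collect_cong, rule conj_cong[OF refl])
    fix w assume "w \<in> lists {0..<k}"
    then show "run B.M n w = \<iota> i \<longleftrightarrow> run A.M n w = i"
      using run_\<iota>[of w n] \<iota>_n \<iota>_eq_iff[OF _ assms] A.run_le[of w n] by simp
  qed
  moreover have "triple_seq n k s' d' r' ` ?W = triple_seq n k s d r ` ?W"
    using triple_seq_\<iota> by (intro image_cong) auto
  moreover have "(\<forall>w\<in>?W. \<psi> \<le> triple_seq n k s' d' r' w) = (\<forall>w\<in>?W. \<psi> \<le> triple_seq n k s d r w)"
    for \<psi> using triple_seq_\<iota> by auto
  ultimately show ?thesis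
    unfolding is_char_word_def Let_def fun_eq_iff by simp
qed

section \<open>Rigidity and equality of the strings\<close>

lemma Delta_\<iota>:
  assumes "p \<le> n" and "\<And>m. m < k \<Longrightarrow> \<iota> (A.\<delta> p m) = A.\<delta> p m"
  shows "Delta k s' (\<iota> p) = Delta k s p"
  unfolding Delta_def using assms \<iota>_\<delta> finality_\<iota>
  by (auto simp: less_Suc_eq intro!: map_cong)

lemma \<iota>_id: "i \<le> n \<Longrightarrow> \<iota> i = i"
proof (induction i rule: less_induct)
  case (less i)
  show ?case
  proof (rule ccontr)
    assume neq: "\<iota> i \<noteq> i"
    then have i: "1 \<le> i" using \<iota>_0 by (cases i) auto
    have "i \<in> \<iota> ` {0..n}" using bij less.prems by (auto simp: bij_betw_def)
    then obtain i' where i': "i' \<le> n" "\<iota> i' = i" by auto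
    have "i < i'" using less.IH[of i'] i' neq by (cases i i' rule: linorder_cases) auto
    have "i < \<iota> i"
      using less.IH[of "\<iota> i"] \<iota>_eq_iff[of "\<iota> i" i] \<iota>_le neq less.prems
      by (cases i "\<iota> i" rule: linorder_cases) auto
    have "Delta k s' (\<iota> i) = Delta k s i"
      using A.\<delta>_less i less by (intro Delta_\<iota>) force+
    \<comment> \<open>Since \<open>i < i'\<close>, the successors of \<open>i'\<close> are not known
      in advance to lie below \<open>i\<close>. Their images are successors of
      \<open>\<iota> i' = i\<close>, hence lie below \<open>i\<close> and are fixed; injectivity
      then makes each successor equal to its image.\<close>
    moreover have "Delta k s' (\<iota> i') = Delta k s i'"
    proof (rule Delta_\<iota>[OF i'(1)])
      fix m assume m: "m < k"
      let ?q = "A.\<delta> i' m"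
      have q: "?q \<le> n" using A.\<delta>_less_n[of i' m] i' m by simp
      have "\<iota> ?q < i" using B.\<delta>_less[of i m] \<iota>_\<delta> i' i m less.prems by simp
      then show "\<iota> ?q = ?q"
        using less.IH[of "\<iota> ?q"] \<iota>_eq_iff[of "\<iota> ?q" ?q] \<iota>_le q less.prems by auto
    qed
    moreover have "prec_char n k s d r i i'"
      using A.prec_char_if_less i i' \<open>i < i'\<close> by simp
    ultimately have "prec_char n k s' d' r' (\<iota> i) i"
      using is_char_word_\<iota>[of i] is_char_word_\<iota>[of i'] i' less.prems
      by (simp add: prec_char_def)
    moreover have "prec_char n k s' d' r' i (\<iota> i)"
      using B.prec_char_if_less i \<open>i < \<iota> i\<close> \<iota>_le less.prems by simp
    ultimately show False using prec_char_trans prec_char_irrefl by blast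
  qed
qed

lemma strings_eq: "s = s'"
proof (rule nth_equalityI)
  show "length s = length s'" using A.length_s B.length_s by simp
  fix x assume "x < length s"
  then have "x div (k + 1) < n + 1"
    using A.length_s by (intro less_mult_imp_div_less) (simp add: mult.commute)
  \<comment> \<open>Row \<open>p\<close> describes state \<open>p\<close>; its columns
    \<open>m < k\<close> are transitions and column \<open>k\<close> is the finality.\<close>
  define p m where "p = x div (k + 1)" and "m = x mod (k + 1)"
  have x: "x = (k + 1) * p + m" unfolding p_def m_def by (rule mult_div_mod_eq[symmetric])
  have p: "p \<le> n" using \<open>x div (k + 1) < n + 1\<close> by (simp add: p_def)
  have "m < k + 1" by (simp add: m_def)
  then consider "m < k" | "m = k" by linarith
  then show "s ! x = s' ! x"
  proof cases
    case 1
    have "A.\<delta> p m \<le> n" using A.\<delta>_less_n[of p m] p 1 by simp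
    then show ?thesis using \<iota>_\<delta>[OF p 1] \<iota>_id p x by simp
  next
    case 2
    then show ?thesis using finality_\<iota>[OF p] \<iota>_id[OF p] x by simp
  qed
qed

end

section \<open>From the conditions to non-isomorphism\<close>

lemma satisfies_N_numbered_string:
  assumes "n \<ge> 2" "length s = (k + 1) * (n + 1)" "set s \<subseteq> {0..<n}" "satisfies_N n k s"
  obtains d r f where "numbered_string n k s d r f"
proof -
  from assms(4) obtain d r f where
    "r (-1) = 0" "r (int d + 1) = n + 1"
    "\<forall>i \<in> {1..<n}. \<exists>j \<in> {0..n}. \<exists>m \<in> {0..<k}. f i = (k + 1) * j + m"
    "N0 k s" "N1 n k s" "N2 n d r" "N3 n k s f" "N4 k d r f" "N5 k s d r" "N6' n k s d r"
    unfolding satisfies_N_def by (elim exE conjE)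
  with assms(1-3) have "numbered_string n k s d r f"
    by (intro numbered_string.intro) (simp_all only:)
  then show thesis by (rule that)
qed

theorem theorem4:
  fixes n k :: nat and s s' :: "nat list"
  assumes "n \<ge> 2"
    and "length s = (k + 1) * (n + 1)" and "set s \<subseteq> {0..<n}"
    and "length s' = (k + 1) * (n + 1)" and "set s' \<subseteq> {0..<n}"
    and "satisfies_N n k s" and "satisfies_N n k s'"
    and "s \<noteq> s'"
  shows "adfa (string_dfa n k s) 0 \<and> adfa (string_dfa n k s') 0 \<and>
         \<not> dfa_isomorphic (string_dfa n k s) (string_dfa n k s')"
proof -
  let ?M = "string_dfa n k s" and ?M' = "string_dfa n k s'"
  obtain d r f where A: "numbered_string n k s d r f"
    using satisfies_N_numbered_string assms by metis
  obtain d' r' f' where B: "numbered_string n k s' d' r' f'"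
    using satisfies_N_numbered_string assms by metis
  have "\<not> dfa_isomorphic ?M ?M'"
  proof
    assume "dfa_isomorphic ?M ?M'"
    then obtain \<Pi>1 \<Pi>2 \<iota> where
      \<Pi>1: "bij_betw \<Pi>1 {0..<k} {0..<k}" "strict_mono_on {0..<k} \<Pi>1" and
      \<Pi>2: "bij_betw \<Pi>2 {0..<k} {0..<k}" "strict_mono_on {0..<k} \<Pi>2" and
      \<iota>: "bij_betw \<iota> {0..n} {0..n}" "\<iota> n = n" "\<iota> ` final ?M = final ?M'" and
      step: "\<forall>m\<in>{0..<k}. \<forall>q\<in>{0..n}.
        \<iota> (step ?M q m) = step ?M' (\<iota> q) (inv_into {0..<k} \<Pi>2 (\<Pi>1 m))"
      unfolding dfa_isomorphic_def by (auto simp: string_dfa_def)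
    \<comment> \<open>Both increasing bijections are the identity on \<open>{0..<k}\<close>, so the
      isomorphism preserves each letter.\<close>
    have "inv_into {0..<k} \<Pi>2 (\<Pi>1 m) = m" if "m < k" for m
    proof -
      have "\<Pi>1 m = \<Pi>2 m"
        using strict_mono_on_bij_betw_atLeast0LessThan \<Pi>1 \<Pi>2 that by metis
      then show ?thesis using \<Pi>2(1) that by (simp add: bij_betw_def)
    qed
    then have "numbered_strings_iso n k s d r f s' d' r' f' \<iota>"
      using A B \<iota> step
      by (simp add: numbered_strings_iso_def numbered_strings_iso_axioms_def
          numbered_string.step_M[OF A] numbered_string.step_M[OF B])
    with \<open>s \<noteq> s'\<close> show False using numbered_strings_iso.strings_eq by blast
  qed
  then show ?thesis using numbered_string.adfa[OF A] numbered_string.adfa[OF B] by blast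
qed

end
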